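(* Let $R$ be a finite ring. Then $|\operatorname{Cent}(R)| = 5$ if and only if the additive quotient group $R/Z(R)$ is isomorphic, as a group, to $\mathbb{Z}_3 \times \mathbb{Z}_3$.
   Context: Rings are associative and not assumed to have a unity. For $r \in R$, the centralizer of $r$ is the subring $C(r) = \{s \in R : rs = sr\}$, and $\operatorname{Cent}(R) = \{C(r) : r \in R\}$ is the set of all distinct centralizers. $Z(R) = \{s \in R : rs = sr \text{ for all } r \in R\}$ is the center. $R/Z(R)$ denotes the quotient of additive groups, and $\cong$ is isomorphism of additive groups. *)

theory Defs
  imports "HOL-Algebra.Algebra"
begin

text \<open>
  The library's locale \<open>ring\<close> includes a multiplicative unit.  The rings here are associative but
  need not have one: the field \<open>one\<close> of the underlying record is left unconstrained and
  does not occur in any of the definitions below.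
\<close>

locale nonunital_ring = abelian_group R for R (structure) +
  assumes m_closed: "\<lbrakk>x \<in> carrier R; y \<in> carrier R\<rbrakk> \<Longrightarrow> x \<otimes> y \<in> carrier R"
    and m_assoc: "\<lbrakk>x \<in> carrier R; y \<in> carrier R; z \<in> carrier R\<rbrakk>
      \<Longrightarrow> (x \<otimes> y) \<otimes> z = x \<otimes> (y \<otimes> z)"
    and l_distr: "\<lbrakk>x \<in> carrier R; y \<in> carrier R; z \<in> carrier R\<rbrakk>
      \<Longrightarrow> (x \<oplus> y) \<otimes> z = x \<otimes> z \<oplus> y \<otimes> z"
    and r_distr: "\<lbrakk>x \<in> carrier R; y \<in> carrier R; z \<in> carrier R\<rbrakk>
      \<Longrightarrow> z \<otimes> (x \<oplus> y) = z \<otimes> x \<oplus> z \<otimes> y"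

lemma (in ring) nonunital_ring: "nonunital_ring R"
  by unfold_locales (auto simp: m_assoc l_distr r_distr)

definition ring_centralizer :: "('a, 'b) ring_scheme \<Rightarrow> 'a \<Rightarrow> 'a set" where
  "ring_centralizer R r = {s \<in> carrier R. r \<otimes>\<^bsub>R\<^esub> s = s \<otimes>\<^bsub>R\<^esub> r}"

definition ring_Cent :: "('a, 'b) ring_scheme \<Rightarrow> 'a set set" where
  "ring_Cent R = {ring_centralizer R r | r. r \<in> carrier R}"

definition ring_center :: "('a, 'b) ring_scheme \<Rightarrow> 'a set" where
  "ring_center R = {s \<in> carrier R. \<forall>r \<in> carrier R. r \<otimes>\<^bsub>R\<^esub> s = s \<otimes>\<^bsub>R\<^esub> r}"

context nonunital_ring
begin

lemma nu_l_null: assumes "x \<in> carrier R" shows "\<zero> \<otimes> x = \<zero>"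
proof -
  have "\<zero> \<otimes> x \<oplus> \<zero> \<otimes> x = \<zero> \<otimes> x \<oplus> \<zero>"
    using l_distr[of \<zero> \<zero> x] assms m_closed by simp
  then show ?thesis using assms m_closed by (metis a_closed add.l_cancel zero_closed)
qed

lemma nu_r_null: assumes "x \<in> carrier R" shows "x \<otimes> \<zero> = \<zero>"
proof -
  have "x \<otimes> \<zero> \<oplus> x \<otimes> \<zero> = x \<otimes> \<zero> \<oplus> \<zero>"
    using r_distr[of \<zero> \<zero> x] assms m_closed by simp
  then show ?thesis using assms m_closed by (metis a_closed add.l_cancel zero_closed)
qed

lemma nu_l_minus:
  assumes "x \<in> carrier R" "y \<in> carrier R" shows "(\<ominus> x) \<otimes> y = \<ominus> (x \<otimes> y)"
proof -
  have "(\<ominus> x) \<otimes> y \<oplus> x \<otimes> y = \<zero>"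
    using l_distr[of "\<ominus> x" x y] assms by (simp add: l_neg nu_l_null)
  then show ?thesis using assms m_closed by (simp add: minus_equality)
qed

lemma nu_r_minus:
  assumes "x \<in> carrier R" "y \<in> carrier R" shows "x \<otimes> (\<ominus> y) = \<ominus> (x \<otimes> y)"
proof -
  have "x \<otimes> (\<ominus> y) \<oplus> x \<otimes> y = \<zero>"
    using r_distr[of "\<ominus> y" y x] assms by (simp add: l_neg nu_r_null)
  then show ?thesis using assms m_closed by (simp add: minus_equality)
qed

lemma ring_center_normal: "ring_center R \<lhd> add_monoid R"
proof -
  have "subgroup (ring_center R) (add_monoid R)"
  proof (rule add.subgroupI)
    show "ring_center R \<noteq> {}"
      using nu_l_null nu_r_null by (force simp: ring_center_def)
  next
    fix a assume "a \<in> ring_center R"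
    then show "\<ominus> a \<in> ring_center R"
      by (auto simp: ring_center_def nu_l_minus nu_r_minus)
  qed (auto simp: ring_center_def l_distr r_distr)
  then show ?thesis
    using a_comm_group by (simp add: comm_group.subgroup_imp_normal)
qed

end

end

theory Submission
  imports Defs
begin

text \<open>
  The centralizer of \<open>r\<close> is the kernel of the additive map \<open>s \<mapsto> [r, s]\<close>, where \<open>[r, s] = rs - sr\<close>.
  So the theorem is about an alternating biadditive form whose radical is the center \<open>Z\<close>.
  Both directions pass through one property, \<open>mod3_plane a b\<close>: every element is an integer combination of \<open>a\<close> and \<open>b\<close> modulo \<open>Z\<close>,
  and \<open>[a, b]\<close> has order exactly \<open>3\<close>.

  If \<open>a\<close> and \<open>b\<close> form such a plane, then \<open>[ia + jb, ka + lb] = (il - jk)[a, b]\<close> vanishes exactly when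
  \<open>3\<close> divides the determinant.  Hence \<open>ia + jb\<close> is central exactly when \<open>3\<close> divides \<open>i\<close> and \<open>j\<close>,
  which is to say that \<open>R/Z\<close> is \<open>\<int>\<^sub>3 \<times> \<int>\<^sub>3\<close> with basis \<open>a, b\<close>; and the proper centralizers
  are those of \<open>a\<close>, \<open>b\<close>, \<open>a + b\<close>, \<open>a - b\<close>, one for each line in the plane over the field of three
  elements (\<open>center_quotient_iso_iff_mod3_plane\<close>, \<open>mod3_plane_card_Cent\<close>).

  Conversely, let there be five centralizers, that is, four proper ones.  Elements that do not commute
  have different proper centralizers, so there are at most four pairwise noncommuting elements.
  If some bracket satisfies \<open>2[a, b] \<noteq> 0\<close>, then \<open>a\<close>, \<open>b\<close>, \<open>a + b\<close>, \<open>a - b\<close> do not commute pairwise and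
  their centralizers are all the proper ones.  Asking which of the four \<open>a + 2b\<close> shares its centralizer
  with forces \<open>3[a, b] = 0\<close> (\<open>odd_pair_torsion\<close>); asking the same of \<open>c + b\<close>, where \<open>c\<close> commutes with \<open>a\<close>,
  forces \<open>c\<close> to be \<open>0\<close>, \<open>a\<close> or \<open>-a\<close> modulo \<open>Z\<close> (\<open>odd_pair_coset\<close>).  As every element commutes with one of the
  four, \<open>a\<close> and \<open>b\<close> span modulo \<open>Z\<close> (\<open>exists_mod3_plane\<close>).

  It remains to exclude that all brackets are killed by \<open>2\<close>.  Then \<open>a\<close>, \<open>b\<close>, \<open>a + b\<close> account for only three
  proper centralizers and there is a \<open>c\<close> with a fourth one.  Comparing the centralizers of sums of \<open>a\<close>, \<open>b\<close>, \<open>c\<close>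
  with the four available ones contradicts every possible pattern of commutation between
  \<open>c\<close> and \<open>a\<close>, \<open>b\<close> (\<open>no_even_frame\<close>).
\<close>

section \<open>Bases of squares of cyclic groups\<close>

text \<open>
  The right-hand side says that \<open>x\<close> and \<open>y\<close> generate \<open>G\<close> with relations \<open>x\<^sup>n = y\<^sup>n = \<one>\<close> and no others.
  Stating it with integer exponents avoids choosing residues, and includes the case \<open>n = 0\<close>, where
  \<open>integer_mod_group 0\<close> is the infinite cyclic group.
\<close>

lemma (in comm_group) iso_DirProd_integer_mod_group_iff:
  "G \<cong> integer_mod_group n \<times>\<times> integer_mod_group n \<longleftrightarrow>
    (\<exists>x \<in> carrier G. \<exists>y \<in> carrier G.
      (\<forall>g \<in> carrier G. \<exists>(i :: int) (j :: int). g = x [^] i \<otimes> y [^] j) \<and>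
      (\<forall>(i :: int) (j :: int). x [^] i \<otimes> y [^] j = \<one> \<longleftrightarrow> int n dvd i \<and> int n dvd j))"
    (is "?iso \<longleftrightarrow> ?basis")
proof -
  let ?Zn = "integer_mod_group n"
  let ?H = "?Zn \<times>\<times> ?Zn"
  have carr: "i mod int n \<in> carrier ?Zn" for i
    by (auto simp: carrier_integer_mod_group)
  have red: "i mod int n = i" if "i \<in> carrier ?Zn" for i
    using that by (auto simp: carrier_integer_mod_group split: if_splits)
  have grpH: "group ?H"
    by (simp add: DirProd_group)
  have powH: "(p, q) [^]\<^bsub>?H\<^esub> (k :: int) = (k * p mod int n, k * q mod int n)"
    if "p \<in> carrier ?Zn" "q \<in> carrier ?Zn" for p q k
  proof -
    have "group_hom ?H ?Zn fst" "group_hom ?H ?Zn snd"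
      by (auto intro!: group_hom.intro grpH simp: group_hom_axioms_def hom_def)
    then have "fst ((p, q) [^]\<^bsub>?H\<^esub> k) = p [^]\<^bsub>?Zn\<^esub> k" "snd ((p, q) [^]\<^bsub>?H\<^esub> k) = q [^]\<^bsub>?Zn\<^esub> k"
      using group_hom.hom_int_pow[of ?H ?Zn fst "(p, q)" k] group_hom.hom_int_pow[of ?H ?Zn snd "(p, q)" k] that
      by simp_all
    then show ?thesis
      by (metis prod.collapse int_pow_integer_mod_group)
  qed
  show ?thesis
  proof
    assume ?iso
    then obtain f where f: "f \<in> iso ?H G"
      using iso_sym by (auto simp: is_iso_def)
    then have hom: "f \<in> hom ?H G" and inj: "inj_on f (carrier ?H)" and surj: "f ` carrier ?H = carrier G"
      by (auto simp: iso_def bij_betw_def)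
    interpret f: group_hom ?H G f
      using hom by (simp add: group_hom_def group_hom_axioms_def grpH)
    \<comment> \<open>The generators are reduced modulo \<open>n\<close> because \<open>1\<close> is not in the carrier when \<open>n = 1\<close>.\<close>
    let ?p = "(1 mod int n, 0 mod int n)" and ?q = "(0 mod int n, 1 mod int n)"
    have pq: "?p \<in> carrier ?H" "?q \<in> carrier ?H"
      using carr by (simp_all only: carrier_DirProd mem_Times_iff fst_conv snd_conv)
    have comb: "f ?p [^] i \<otimes> f ?q [^] j = f (i mod int n, j mod int n)" for i j :: int
    proof -
      have "f ?p [^] i \<otimes> f ?q [^] j = f (?p [^]\<^bsub>?H\<^esub> i \<otimes>\<^bsub>?H\<^esub> ?q [^]\<^bsub>?H\<^esub> j)"
        using pq group.int_pow_closed[OF grpH] by (simp only: f.hom_int_pow f.hom_mult)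
      also have "?p [^]\<^bsub>?H\<^esub> i \<otimes>\<^bsub>?H\<^esub> ?q [^]\<^bsub>?H\<^esub> j = (i mod int n, j mod int n)"
        by (simp only: powH carr) (simp add: mod_simps)
      finally show ?thesis .
    qed
    have one: "(0, 0) \<in> carrier ?H" "f (0, 0) = \<one>"
      using f.hom_one by (simp_all add: one_DirProd)
    show ?basis
    proof (intro bexI conjI ballI allI)
      fix g assume "g \<in> carrier G"
      then have "g \<in> f ` carrier ?H"
        using surj by simp
      then obtain i j where "i \<in> carrier ?Zn" "j \<in> carrier ?Zn" "g = f (i, j)"
        by auto
      then show "\<exists>(i :: int) (j :: int). g = f ?p [^] i \<otimes> f ?q [^] j"
        by (metis comb red)
    next
      fix i :: int and j :: int
      have "f (i mod int n, j mod int n) = \<one> \<longleftrightarrow> (i mod int n, j mod int n) = (0, 0)"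
        using inj_onD[OF inj _ _ one(1), of "(i mod int n, j mod int n)"] one carr by auto
      then show "f ?p [^] i \<otimes> f ?q [^] j = \<one> \<longleftrightarrow> int n dvd i \<and> int n dvd j"
        by (simp only: comb dvd_eq_mod_eq_0 prod.inject)
    qed (use pq in \<open>simp_all only: f.hom_closed\<close>)
  next
    assume ?basis
    then obtain x y where x [simp]: "x \<in> carrier G" and y [simp]: "y \<in> carrier G"
      and span: "\<And>g. g \<in> carrier G \<Longrightarrow> \<exists>(i :: int) (j :: int). g = x [^] i \<otimes> y [^] j"
      and rel: "\<And>(i :: int) (j :: int). x [^] i \<otimes> y [^] j = \<one> \<longleftrightarrow> int n dvd i \<and> int n dvd j"
      by blast
    define h where "h = (\<lambda>(i :: int, j :: int). x [^] i \<otimes> y [^] j)"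
    have h_add: "h (i + k, j + l) = h (i, j) \<otimes> h (k, l)" for i j k l
      by (simp add: h_def int_pow_mult m_ac)
    have h_closed: "h p \<in> carrier G" for p
      by (simp add: h_def split: prod.split)
    have h_mod: "h (i mod int n, j mod int n) = h (i, j)" for i j
    proof -
      have "h (int n * (i div int n), int n * (j div int n)) = \<one>"
        by (simp add: h_def rel)
      then show ?thesis
        using h_add[of "i mod int n" "int n * (i div int n)" "j mod int n" "int n * (j div int n)"]
          h_closed by simp
    qed
    have "h \<in> hom ?H G"
      by (auto intro!: homI simp: h_closed h_mod h_add)
    moreover have "inj_on h (carrier ?H)"
    proof (rule inj_onI, clarsimp)
      fix i j k l
      assume mem: "i \<in> carrier ?Zn" "j \<in> carrier ?Zn" "k \<in> carrier ?Zn" "l \<in> carrier ?Zn"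
        and eq: "h (i, j) = h (k, l)"
      have "h (i, j) = h (i - k, j - l) \<otimes> h (k, l)"
        using h_add[of "i - k" k "j - l" l] by simp
      then have "h (i - k, j - l) = \<one>"
        using eq h_closed by (metis r_cancel_one')
      then have "i mod int n = k mod int n" "j mod int n = l mod int n"
        by (auto simp: h_def rel mod_eq_dvd_iff)
      then show "i = k \<and> j = l"
        using mem red by metis
    qed
    moreover have "h ` carrier ?H = carrier G"
    proof
      show "carrier G \<subseteq> h ` carrier ?H"
      proof
        fix g assume "g \<in> carrier G"
        from span[OF this] obtain i j where "g = h (i, j)"
          by (auto simp: h_def)
        then have "g = h (i mod int n, j mod int n)"
          by (simp add: h_mod)
        then show "g \<in> h ` carrier ?H"
          using carr by auto
      qed
    qed (use h_closed in auto)
    ultimately have "h \<in> iso ?H G"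
      by (simp add: iso_def bij_betw_def)
    then show ?iso
      using group.iso_sym[OF grpH] is_isoI by blast
  qed
qed

section \<open>The commutator bracket and centralizers\<close>

context nonunital_ring
begin

abbreviation centralizer :: "'a \<Rightarrow> 'a set" ("C")
  where "C r \<equiv> ring_centralizer R r"

abbreviation center :: "'a set" ("Z")
  where "Z \<equiv> ring_center R"

definition lie_bracket :: "'a \<Rightarrow> 'a \<Rightarrow> 'a" ("\<langle>_, _\<rangle>")
  where "\<langle>x, y\<rangle> = x \<otimes> y \<ominus> y \<otimes> x"

declare m_closed [simp]

lemma minus_swap: "x \<in> carrier R \<Longrightarrow> y \<in> carrier R \<Longrightarrow> \<ominus> (x \<ominus> y) = y \<ominus> x"
  by (simp add: a_minus_def minus_add minus_minus a_comm)

lemma minus_eq_zero_iff: "x \<in> carrier R \<Longrightarrow> y \<in> carrier R \<Longrightarrow> x \<ominus> y = \<zero> \<longleftrightarrow> x = y"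
  by (simp add: a_minus_def add.inv_solve_right' r_neg minus_equality)

lemma uminus_zero [simp]: "\<ominus> \<zero> = \<zero>"
  by (rule minus_equality) simp_all

lemma uminus_eq_zero_iff [simp]: "x \<in> carrier R \<Longrightarrow> \<ominus> x = \<zero> \<longleftrightarrow> x = \<zero>"
  using minus_minus by fastforce

lemma bracket_closed [simp]:
  "x \<in> carrier R \<Longrightarrow> y \<in> carrier R \<Longrightarrow> \<langle>x, y\<rangle> \<in> carrier R"
  by (simp add: lie_bracket_def)

lemma bracket_add_left:
  assumes "x \<in> carrier R" "y \<in> carrier R" "z \<in> carrier R"
  shows "\<langle>x \<oplus> y, z\<rangle> = \<langle>x, z\<rangle> \<oplus> \<langle>y, z\<rangle>"
  using assms by (simp add: lie_bracket_def a_minus_def l_distr r_distr minus_add a_ac)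

lemma bracket_self [simp]: "x \<in> carrier R \<Longrightarrow> \<langle>x, x\<rangle> = \<zero>"
  by (simp add: lie_bracket_def a_minus_def r_neg)

lemma bracket_swap:
  "x \<in> carrier R \<Longrightarrow> y \<in> carrier R \<Longrightarrow> \<langle>y, x\<rangle> = \<ominus> \<langle>x, y\<rangle>"
  by (simp add: lie_bracket_def minus_swap)

lemma bracket_add_right:
  assumes "x \<in> carrier R" "y \<in> carrier R" "z \<in> carrier R"
  shows "\<langle>x, y \<oplus> z\<rangle> = \<langle>x, y\<rangle> \<oplus> \<langle>x, z\<rangle>"
  using assms by (simp add: lie_bracket_def a_minus_def l_distr r_distr minus_add a_ac)

lemma bracket_minus_left:
  "x \<in> carrier R \<Longrightarrow> y \<in> carrier R \<Longrightarrow> \<langle>\<ominus> x, y\<rangle> = \<ominus> \<langle>x, y\<rangle>"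
  by (simp add: lie_bracket_def a_minus_def nu_l_minus nu_r_minus minus_add)

lemma bracket_minus_right:
  "x \<in> carrier R \<Longrightarrow> y \<in> carrier R \<Longrightarrow> \<langle>x, \<ominus> y\<rangle> = \<ominus> \<langle>x, y\<rangle>"
  by (simp add: lie_bracket_def a_minus_def nu_l_minus nu_r_minus minus_add)

lemmas bracket_simps =
  bracket_add_left bracket_add_right bracket_minus_left bracket_minus_right a_minus_def

lemma bracket_eq_zero_sym:
  assumes "x \<in> carrier R" "y \<in> carrier R"
  shows "\<langle>y, x\<rangle> = \<zero> \<longleftrightarrow> \<langle>x, y\<rangle> = \<zero>"
  using assms by (auto simp: lie_bracket_def minus_eq_zero_iff)

lemma mem_centralizer_iff:
  assumes "r \<in> carrier R"
  shows "s \<in> C r \<longleftrightarrow> s \<in> carrier R \<and> \<langle>r, s\<rangle> = \<zero>"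
  using assms by (auto simp: ring_centralizer_def lie_bracket_def minus_eq_zero_iff)

lemma mem_center_iff:
  "s \<in> Z \<longleftrightarrow> s \<in> carrier R \<and> (\<forall>r \<in> carrier R. \<langle>s, r\<rangle> = \<zero>)"
  by (auto simp: ring_center_def lie_bracket_def minus_eq_zero_iff)

lemma center_closed: "z \<in> Z \<Longrightarrow> z \<in> carrier R"
  by (simp add: mem_center_iff)

lemma bracket_center:
  assumes "z \<in> Z" "x \<in> carrier R"
  shows "\<langle>z, x\<rangle> = \<zero>" "\<langle>x, z\<rangle> = \<zero>"
  using assms by (auto simp: mem_center_iff bracket_eq_zero_sym)

lemma bracket_eq_zero_if_centralizer_eq:
  assumes "x \<in> carrier R" "y \<in> carrier R" "C x = C y"
  shows "\<langle>x, y\<rangle> = \<zero>"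
  using assms mem_centralizer_iff by (metis bracket_self)

lemma centralizer_eq_carrier_iff:
  assumes "x \<in> carrier R"
  shows "C x = carrier R \<longleftrightarrow> x \<in> Z"
  using assms by (auto simp: set_eq_iff mem_centralizer_iff mem_center_iff)

lemma centralizer_uminus:
  "x \<in> carrier R \<Longrightarrow> C (\<ominus> x) = C x"
  by (auto simp: mem_centralizer_iff bracket_minus_left)

lemma centralizer_add_center:
  "x \<in> carrier R \<Longrightarrow> z \<in> Z \<Longrightarrow> C (x \<oplus> z) = C x"
  by (auto simp: mem_centralizer_iff bracket_add_left bracket_center center_closed)

lemma centralizer_cong_center:
  assumes "x \<in> carrier R" "y \<in> carrier R" "x \<ominus> y \<in> Z"
  shows "C x = C y"
proof -
  have "x = y \<oplus> (x \<ominus> y)"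
    using assms by (simp add: a_minus_def a_lcomm r_neg)
  then show ?thesis
    using centralizer_add_center assms by metis
qed

lemma finite_Cent: "card (ring_Cent R) = 5 \<Longrightarrow> finite (ring_Cent R)"
  by (rule card_ge_0_finite) simp

lemma zero_mem_center: "\<zero> \<in> Z"
  using nu_l_null nu_r_null by (auto simp: ring_center_def)

lemma carrier_mem_Cent: "carrier R \<in> ring_Cent R"
  using centralizer_eq_carrier_iff[OF zero_closed] zero_mem_center
  by (auto simp: ring_Cent_def)

text \<open>
  The form in which the cardinality hypothesis is applied: four distinct proper centralizers leave no room
  for another one.
\<close>

lemma Cent_exhausted:
  assumes "card (ring_Cent R) = 5"
    and "{w, x, y, z} \<subseteq> carrier R"
    and "distinct [carrier R, C w, C x, C y, C z]"
    and "r \<in> carrier R"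
  shows "C r \<in> {carrier R, C w, C x, C y, C z}"
proof -
  have "{carrier R, C w, C x, C y, C z} \<subseteq> ring_Cent R"
    using assms(2) carrier_mem_Cent by (auto simp: ring_Cent_def)
  moreover have "card {carrier R, C w, C x, C y, C z} = 5"
    using distinct_card[OF assms(3)] by simp
  ultimately have "{carrier R, C w, C x, C y, C z} = ring_Cent R"
    using assms(1) finite_Cent by (metis card_subset_eq)
  then show ?thesis
    using assms(4) by (auto simp: ring_Cent_def)
qed

text \<open>
  An element lies in its own centralizer, so equal centralizers would make \<open>x\<close> and \<open>y\<close> commute.
\<close>

lemma noncommuting_centralizers:
  assumes "x \<in> carrier R" "y \<in> carrier R" "\<langle>x, y\<rangle> \<noteq> \<zero>"
  shows "C x \<noteq> C y" "C x \<noteq> carrier R" "C y \<noteq> carrier R"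
  using assms bracket_eq_zero_if_centralizer_eq
  by (auto simp: centralizer_eq_carrier_iff bracket_center)

text \<open>
  Noncommutation is inherited by sums, because \<open>[a, a + b] = [a, b] = [a + b, b]\<close>.
\<close>

lemma distinct_three_centralizers:
  assumes [simp]: "a \<in> carrier R" "b \<in> carrier R" and u: "\<langle>a, b\<rangle> \<noteq> \<zero>"
  shows "distinct [carrier R, C a, C b, C (a \<oplus> b)]"
proof -
  have "\<langle>a, a \<oplus> b\<rangle> \<noteq> \<zero>" "\<langle>b, a \<oplus> b\<rangle> \<noteq> \<zero>"
    using u by (simp_all add: bracket_add_right bracket_eq_zero_sym[of a b])
  then have "C a \<noteq> C b" "C a \<noteq> C (a \<oplus> b)" "C b \<noteq> C (a \<oplus> b)"
    "carrier R \<noteq> C a" "carrier R \<noteq> C b" "carrier R \<noteq> C (a \<oplus> b)"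
    using u noncommuting_centralizers[of a b] noncommuting_centralizers[of a "a \<oplus> b"]
      noncommuting_centralizers[of b "a \<oplus> b"] by simp_all
  then show ?thesis
    by simp
qed

lemma minus_double_eq_zero_iff:
  "x \<in> carrier R \<Longrightarrow> \<ominus> x \<oplus> \<ominus> x = \<zero> \<longleftrightarrow> x \<oplus> x = \<zero>"
  using uminus_eq_zero_iff[of "x \<oplus> x"] by (simp add: minus_add)

section \<open>A bracket not killed by two\<close>

definition odd_pair :: "'a \<Rightarrow> 'a \<Rightarrow> bool"
  where "odd_pair a b \<longleftrightarrow> a \<in> carrier R \<and> b \<in> carrier R \<and> \<langle>a, b\<rangle> \<oplus> \<langle>a, b\<rangle> \<noteq> \<zero>"

lemma odd_pair_bracket: "odd_pair a b \<Longrightarrow> \<langle>a, b\<rangle> \<noteq> \<zero>"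
  by (auto simp: odd_pair_def)

text \<open>
  The bracket of each of these pairs is \<open>\<plusminus>[a, b]\<close>.  Through them, what is proved about the first
  component of a pair applies to \<open>a\<close>, \<open>b\<close>, \<open>a + b\<close> and \<open>a - b\<close> alike.
\<close>

lemma odd_pair_variants:
  assumes "odd_pair a b"
  shows "odd_pair b a" "odd_pair (a \<oplus> b) b" "odd_pair (a \<ominus> b) b"
  using assms by (auto simp: odd_pair_def bracket_simps bracket_swap[of a b] minus_double_eq_zero_iff)

text \<open>
  The only bracket among the four that is not \<open>\<plusminus>[a, b]\<close> is \<open>[a + b, a - b] = -2[a, b]\<close>; this is where
  the factor two in \<open>odd_pair\<close> is needed.
\<close>

lemma odd_pair_distinct:
  assumes ab: "odd_pair a b"
  shows "distinct [carrier R, C a, C b, C (a \<oplus> b), C (a \<ominus> b)]"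
proof -
  have [simp]: "a \<in> carrier R" "b \<in> carrier R"
    and u: "\<langle>a, b\<rangle> \<noteq> \<zero>" "\<langle>a, b\<rangle> \<oplus> \<langle>a, b\<rangle> \<noteq> \<zero>"
    using ab odd_pair_bracket by (auto simp: odd_pair_def)
  have "\<langle>a, a \<ominus> b\<rangle> \<noteq> \<zero>" "\<langle>b, a \<ominus> b\<rangle> \<noteq> \<zero>" "\<langle>a \<oplus> b, a \<ominus> b\<rangle> \<noteq> \<zero>"
    using u by (simp_all add: bracket_simps bracket_swap[of a b] minus_double_eq_zero_iff)
  then have "C a \<noteq> C (a \<ominus> b)" "C b \<noteq> C (a \<ominus> b)" "C (a \<oplus> b) \<noteq> C (a \<ominus> b)"
    "carrier R \<noteq> C (a \<ominus> b)"
    using noncommuting_centralizers[of a "a \<ominus> b"] noncommuting_centralizers[of b "a \<ominus> b"]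
      noncommuting_centralizers[of "a \<oplus> b" "a \<ominus> b"] by simp_all
  then show ?thesis
    using distinct_three_centralizers[OF _ _ u(1)] by simp
qed

lemma odd_pair_classes:
  assumes "card (ring_Cent R) = 5" "odd_pair a b" "r \<in> carrier R"
  shows "C r \<in> {carrier R, C a, C b, C (a \<oplus> b), C (a \<ominus> b)}"
  using assms by (intro Cent_exhausted odd_pair_distinct) (auto simp: odd_pair_def)

text \<open>
  None of the four proper centralizers contains both \<open>a\<close> and \<open>b\<close>, so that of \<open>c\<close> is not among them.
\<close>

lemma odd_pair_center:
  assumes "card (ring_Cent R) = 5" "odd_pair a b" "c \<in> carrier R"
    and "\<langle>a, c\<rangle> = \<zero>" "\<langle>b, c\<rangle> = \<zero>"
  shows "c \<in> Z"
proof -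
  have [simp]: "a \<in> carrier R" "b \<in> carrier R" and u: "\<langle>a, b\<rangle> \<noteq> \<zero>"
    using assms odd_pair_bracket by (auto simp: odd_pair_def)
  have "a \<in> C c" "b \<in> C c"
    using assms by (auto simp: mem_centralizer_iff bracket_eq_zero_sym)
  moreover have "b \<notin> C a" "a \<notin> C b" "a \<notin> C (a \<oplus> b)" "a \<notin> C (a \<ominus> b)"
    using u by (auto simp: mem_centralizer_iff bracket_simps bracket_eq_zero_sym[of a b]
        bracket_swap[of a b])
  ultimately have "C c = carrier R"
    using odd_pair_classes[OF assms(1-3)] by auto
  then show ?thesis
    using assms(3) by (simp add: centralizer_eq_carrier_iff)
qed

text \<open>
  The element \<open>a + 2b\<close> commutes with none of \<open>a\<close>, \<open>b\<close>, \<open>a + b\<close>, so it has to share its centralizer with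
  \<open>a - b\<close>; but \<open>[a + 2b, a - b] = -3[a, b]\<close>.
\<close>

lemma odd_pair_torsion:
  assumes card: "card (ring_Cent R) = 5" and ab: "odd_pair a b"
  shows "\<langle>a, b\<rangle> \<oplus> \<langle>a, b\<rangle> \<oplus> \<langle>a, b\<rangle> = \<zero>"
proof -
  have [simp]: "a \<in> carrier R" "b \<in> carrier R"
    and u: "\<langle>a, b\<rangle> \<noteq> \<zero>" "\<langle>a, b\<rangle> \<oplus> \<langle>a, b\<rangle> \<noteq> \<zero>"
    using ab odd_pair_bracket by (auto simp: odd_pair_def)
  let ?d = "a \<oplus> (b \<oplus> b)"
  have "\<langle>?d, a\<rangle> \<noteq> \<zero>" "\<langle>?d, b\<rangle> \<noteq> \<zero>"
    using u by (simp_all add: bracket_simps bracket_swap[of a b] minus_double_eq_zero_iff)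
  moreover have "\<langle>?d, a \<oplus> b\<rangle> = \<ominus> \<langle>a, b\<rangle>"
    by (simp add: bracket_simps bracket_swap[of a b] r_neg2 a_ac)
  then have "\<langle>?d, a \<oplus> b\<rangle> \<noteq> \<zero>"
    using u by simp
  ultimately have "C ?d \<noteq> C a" "C ?d \<noteq> C b" "C ?d \<noteq> C (a \<oplus> b)" "C ?d \<noteq> carrier R"
    using noncommuting_centralizers by (metis a_closed \<open>a \<in> carrier R\<close> \<open>b \<in> carrier R\<close>)+
  then have "C ?d = C (a \<ominus> b)"
    using odd_pair_classes[OF card ab, of ?d] by simp
  then have "\<langle>?d, a \<ominus> b\<rangle> = \<zero>"
    by (intro bracket_eq_zero_if_centralizer_eq) auto
  moreover have "\<langle>?d, a \<ominus> b\<rangle> = \<ominus> (\<langle>a, b\<rangle> \<oplus> \<langle>a, b\<rangle> \<oplus> \<langle>a, b\<rangle>)"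
    by (simp add: bracket_simps bracket_swap[of a b] minus_add a_ac)
  ultimately show ?thesis
    by simp
qed

text \<open>
  Since \<open>c + b\<close> does not commute with \<open>a\<close>, it shares its centralizer with one of \<open>b\<close>, \<open>a + b\<close>, \<open>a - b\<close>.
  Then \<open>b\<close> commutes with \<open>c\<close>, \<open>c - a\<close> or \<open>c + a\<close>, respectively, and so does \<open>a\<close>, which makes that
  element central by \<open>odd_pair_center\<close>.
\<close>

lemma odd_pair_coset:
  assumes card: "card (ring_Cent R) = 5" and ab: "odd_pair a b"
    and c: "c \<in> carrier R" and ac: "\<langle>a, c\<rangle> = \<zero>"
  shows "c \<in> Z \<or> c \<ominus> a \<in> Z \<or> c \<oplus> a \<in> Z"
proof -
  have [simp]: "a \<in> carrier R" "b \<in> carrier R" "c \<in> carrier R"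
    and u: "\<langle>a, b\<rangle> \<noteq> \<zero>" "\<langle>a, b\<rangle> \<oplus> \<langle>a, b\<rangle> \<noteq> \<zero>"
    using ab c odd_pair_bracket by (auto simp: odd_pair_def)
  have ca: "\<langle>c, a\<rangle> = \<zero>"
    using ac by (simp add: bracket_eq_zero_sym)
  have *: "x \<in> Z" if "x \<in> carrier R" "\<langle>a, x\<rangle> = \<zero>" "\<langle>b, x\<rangle> = \<zero>" for x
    using odd_pair_center[OF card ab] that by blast
  have "\<langle>c \<oplus> b, a\<rangle> \<noteq> \<zero>"
    using u ca by (simp add: bracket_simps bracket_swap[of a b])
  then have "C (c \<oplus> b) \<noteq> carrier R" "C (c \<oplus> b) \<noteq> C a"
    using noncommuting_centralizers[of "c \<oplus> b" a] by auto
  then consider "C (c \<oplus> b) = C b" | "C (c \<oplus> b) = C (a \<oplus> b)" | "C (c \<oplus> b) = C (a \<ominus> b)"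
    using odd_pair_classes[OF card ab, of "c \<oplus> b"] by auto
  then show ?thesis
  proof cases
    case 1
    then have "\<langle>b, c \<oplus> b\<rangle> = \<zero>"
      by (intro bracket_eq_zero_if_centralizer_eq) simp_all
    then have "\<langle>b, c\<rangle> = \<zero>"
      by (simp add: bracket_simps)
    then show ?thesis
      using *[of c] ac by simp
  next
    case 2
    then have "\<langle>a \<oplus> b, c \<oplus> b\<rangle> = \<zero>"
      by (intro bracket_eq_zero_if_centralizer_eq) simp_all
    then have "\<langle>b, c \<ominus> a\<rangle> = \<zero>"
      using ac by (simp add: bracket_simps bracket_swap[of a b] a_ac)
    then show ?thesis
      using * ac by (simp add: bracket_simps)
  next
    case 3
    then have "\<langle>a \<ominus> b, c \<oplus> b\<rangle> = \<zero>"
      by (intro bracket_eq_zero_if_centralizer_eq) simp_all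
    then have "\<ominus> \<langle>b, c \<oplus> a\<rangle> = \<zero>"
      using ac by (simp add: bracket_simps bracket_swap[of a b] minus_add a_ac)
    then have "\<langle>b, c \<oplus> a\<rangle> = \<zero>"
      by simp
    then show ?thesis
      using * ac by (simp add: bracket_simps)
  qed
qed

section \<open>All brackets killed by two\<close>

text \<open>
  The configuration to be excluded: \<open>a\<close>, \<open>b\<close>, \<open>a + b\<close> have three of the four proper centralizers, and
  \<open>c\<close> has the fourth.
\<close>

definition even_frame :: "'a \<Rightarrow> 'a \<Rightarrow> 'a \<Rightarrow> bool"
  where "even_frame a b c \<longleftrightarrow> a \<in> carrier R \<and> b \<in> carrier R \<and> c \<in> carrier R \<and>
    \<langle>a, b\<rangle> \<noteq> \<zero> \<and> C c \<notin> {carrier R, C a, C b, C (a \<oplus> b)} \<and>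
    (\<forall>r \<in> carrier R. C r \<in> {carrier R, C a, C b, C (a \<oplus> b), C c})"

lemma even_frame_class:
  assumes "even_frame a b c" "r \<in> carrier R"
  shows "C r \<in> {carrier R, C a, C b, C (a \<oplus> b), C c}"
  using assms unfolding even_frame_def by blast

lemma even_frame_commutes:
  assumes "even_frame a b c" "r \<in> carrier R" "r \<notin> Z"
  shows "\<langle>r, a\<rangle> = \<zero> \<or> \<langle>r, b\<rangle> = \<zero> \<or> \<langle>r, a \<oplus> b\<rangle> = \<zero> \<or> \<langle>r, c\<rangle> = \<zero>"
proof -
  have "a \<in> carrier R" "b \<in> carrier R" "a \<oplus> b \<in> carrier R" "c \<in> carrier R"
    "C r \<in> {C a, C b, C (a \<oplus> b), C c}"
    using assms even_frame_class[OF assms(1,2)]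
    by (simp_all add: even_frame_def centralizer_eq_carrier_iff)
  then show ?thesis
    using bracket_eq_zero_if_centralizer_eq[OF assms(2), of a]
      bracket_eq_zero_if_centralizer_eq[OF assms(2), of b]
      bracket_eq_zero_if_centralizer_eq[OF assms(2), of "a \<oplus> b"]
      bracket_eq_zero_if_centralizer_eq[OF assms(2), of c] by auto
qed

text \<open>
  If \<open>d\<close> had the centralizer of \<open>a\<close>, there would be none left for \<open>a + c\<close>.  It does not commute with \<open>d\<close>, hence
  does not have the centralizer of \<open>a\<close>; it commutes with \<open>a\<close>, unlike \<open>b\<close> and \<open>a + b\<close>; and it does not
  commute with \<open>b\<close>, unlike \<open>c\<close>.
\<close>

lemma even_frame_not_orthogonal:
  assumes "even_frame a b c" "\<langle>a, c\<rangle> = \<zero>" "\<langle>b, c\<rangle> = \<zero>" "d \<in> carrier R" "\<langle>c, d\<rangle> \<noteq> \<zero>"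
  shows "C d \<noteq> C a"
proof
  assume "C d = C a"
  have [simp]: "a \<in> carrier R" "b \<in> carrier R" "c \<in> carrier R" and u: "\<langle>a, b\<rangle> \<noteq> \<zero>"
    using assms by (auto simp: even_frame_def)
  have classes: "C (a \<oplus> c) \<in> {carrier R, C a, C b, C (a \<oplus> b), C c}"
    by (rule even_frame_class[OF assms(1)]) simp
  have "\<langle>c, b\<rangle> = \<zero>"
    using assms(3) by (simp add: bracket_eq_zero_sym)
  have "d \<in> C a"
    using assms(4) \<open>C d = C a\<close> by (metis mem_centralizer_iff bracket_self)
  moreover have "d \<notin> C (a \<oplus> c)"
    using assms \<open>d \<in> C a\<close> by (simp add: mem_centralizer_iff bracket_add_left)
  moreover have "b \<in> C c" "b \<notin> C (a \<oplus> c)"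
    using \<open>\<langle>c, b\<rangle> = \<zero>\<close> u by (simp_all add: mem_centralizer_iff bracket_add_left)
  moreover have "a \<in> C (a \<oplus> c)" "a \<notin> C b" "a \<notin> C (a \<oplus> b)"
    using assms(2) u by (simp_all add: mem_centralizer_iff bracket_add_left
        bracket_eq_zero_sym[of a b] bracket_eq_zero_sym[of a c])
  ultimately show False
    using classes assms(4) by auto
qed

context
  assumes two_torsion: "\<And>x y. x \<in> carrier R \<Longrightarrow> y \<in> carrier R \<Longrightarrow> \<langle>x, y\<rangle> \<oplus> \<langle>x, y\<rangle> = \<zero>"
begin

lemma bracket_sym:
  "x \<in> carrier R \<Longrightarrow> y \<in> carrier R \<Longrightarrow> \<langle>y, x\<rangle> = \<langle>x, y\<rangle>"
  by (metis two_torsion bracket_swap bracket_closed minus_equality)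

lemma double_mem_center: "x \<in> carrier R \<Longrightarrow> x \<oplus> x \<in> Z"
  by (simp add: mem_center_iff bracket_add_left two_torsion)

text \<open>
  The roles of \<open>a\<close>, \<open>b\<close> and \<open>a + b\<close> are interchangeable, because \<open>(a + b) + a\<close> equals \<open>b\<close> modulo \<open>Z\<close>.
\<close>

lemma even_frame_variants:
  assumes "even_frame a b c"
  shows "even_frame b a c" "even_frame (a \<oplus> b) a c"
proof -
  have [simp]: "a \<in> carrier R" "b \<in> carrier R" and u: "\<langle>a, b\<rangle> \<noteq> \<zero>"
    using assms by (auto simp: even_frame_def)
  show "even_frame b a c"
    using assms by (simp add: even_frame_def bracket_eq_zero_sym[of a b] a_comm[of b a]
        insert_commute del: insert_iff)
  have "a \<oplus> b \<oplus> a = b \<oplus> (a \<oplus> a)"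
    by (simp add: a_ac)
  then have "C (a \<oplus> b \<oplus> a) = C b"
    by (simp add: centralizer_add_center double_mem_center)
  moreover have "\<langle>a \<oplus> b, a\<rangle> \<noteq> \<zero>"
    using u by (simp add: bracket_add_left bracket_eq_zero_sym)
  ultimately show "even_frame (a \<oplus> b) a c"
    using assms by (simp add: even_frame_def insert_commute del: insert_iff)
qed

text \<open>
  Let \<open>c\<close> commute with \<open>a\<close>.  If it also commutes with \<open>b\<close>, then an element \<open>d\<close> not commuting with \<open>c\<close> has
  no centralizer left, by \<open>even_frame_not_orthogonal\<close> for the frames on \<open>a\<close>, \<open>b\<close> and \<open>a + b\<close>.
  If it does not commute with \<open>b\<close>, then \<open>b + c\<close> can only commute with \<open>a + b\<close>, which means that \<open>a + c\<close>
  commutes with \<open>b\<close>.  It also commutes with \<open>a\<close>, so it is central, and \<open>c\<close> has the centralizer of \<open>a\<close>.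
\<close>

lemma even_frame_first_noncommuting:
  assumes frame: "even_frame a b c"
  shows "\<langle>a, c\<rangle> \<noteq> \<zero>"
proof
  assume ac: "\<langle>a, c\<rangle> = \<zero>"
  have [simp]: "a \<in> carrier R" "b \<in> carrier R" "c \<in> carrier R" and u: "\<langle>a, b\<rangle> \<noteq> \<zero>"
    and c: "C c \<notin> {carrier R, C a, C b, C (a \<oplus> b)}"
    using frame by (auto simp: even_frame_def)
  have ca: "\<langle>c, a\<rangle> = \<zero>"
    using ac by (simp add: bracket_eq_zero_sym)
  show False
  proof (cases "\<langle>b, c\<rangle> = \<zero>")
    case True
    have "c \<notin> Z"
      using c centralizer_eq_carrier_iff[of c] by simp
    then obtain d where d: "d \<in> carrier R" "\<langle>c, d\<rangle> \<noteq> \<zero>"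
      by (auto simp: mem_center_iff)
    note frames = frame even_frame_variants[OF frame]
    have "C d \<noteq> C a" "C d \<noteq> C b" "C d \<noteq> C (a \<oplus> b)"
      using frames[THEN even_frame_not_orthogonal, OF _ _ d] ac True
      by (simp_all add: bracket_add_left)
    moreover have "C d \<noteq> carrier R" "C d \<noteq> C c"
      using noncommuting_centralizers[of c d] d by auto
    ultimately show False
      using even_frame_class[OF frame d(1)] by simp
  next
    case False
    have "\<langle>b \<oplus> c, a\<rangle> \<noteq> \<zero>" "\<langle>b \<oplus> c, b\<rangle> \<noteq> \<zero>" "\<langle>b \<oplus> c, c\<rangle> \<noteq> \<zero>"
      using u ca False by (simp_all add: bracket_add_left bracket_eq_zero_sym[of a b] bracket_eq_zero_sym[of b c])
    then have "\<langle>b \<oplus> c, a \<oplus> b\<rangle> = \<zero>"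
      using even_frame_commutes[OF frame, of "b \<oplus> c"] bracket_center(1)[of "b \<oplus> c" a] by auto
    then have sum: "\<langle>a, b\<rangle> \<oplus> \<langle>b, c\<rangle> = \<zero>"
      using ca by (simp add: bracket_add_left bracket_add_right bracket_sym[of a b] bracket_sym[of b c])
    have "b \<in> C (a \<oplus> c)" "a \<in> C (a \<oplus> c)"
      using sum ca by (simp_all add: mem_centralizer_iff bracket_add_left bracket_sym[of b c])
    moreover have "b \<notin> C a" "a \<notin> C b" "a \<notin> C (a \<oplus> b)" "b \<notin> C c"
      using u False by (simp_all add: mem_centralizer_iff bracket_add_left bracket_eq_zero_sym)
    ultimately have "C (a \<oplus> c) = carrier R"
      using even_frame_class[OF frame, of "a \<oplus> c"] by auto
    then have "a \<oplus> c \<in> Z"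
      by (simp add: centralizer_eq_carrier_iff)
    moreover have "c = \<ominus> a \<oplus> (a \<oplus> c)"
      by (simp add: r_neg1)
    ultimately have "C c = C a"
      by (metis centralizer_add_center centralizer_uminus a_inv_closed \<open>a \<in> carrier R\<close>)
    then show False
      using c by simp
  qed
qed

text \<open>
  By the previous lemma and the symmetry of frames, \<open>c\<close> commutes with none of \<open>a\<close>, \<open>b\<close>, \<open>a + b\<close>.  Then
  neither do \<open>a + c\<close>, \<open>b + c\<close> and \<open>a + b + c\<close> commute with \<open>c\<close>, so each of them commutes with one of
  \<open>a\<close>, \<open>b\<close>, \<open>a + b\<close>.  Each time this leaves two linear conditions on the brackets of
  \<open>a\<close>, \<open>b\<close>, \<open>c\<close> of which one must hold, and no choice of three is consistent.
\<close>

lemma no_even_frame: "\<not> even_frame a b c"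
proof
  assume frame: "even_frame a b c"
  have [simp]: "a \<in> carrier R" "b \<in> carrier R" "c \<in> carrier R" and u: "\<langle>a, b\<rangle> \<noteq> \<zero>"
    using frame by (auto simp: even_frame_def)
  define U V W where "U = \<langle>a, b\<rangle>" and "V = \<langle>a, c\<rangle>" and "W = \<langle>b, c\<rangle>"
  have [simp]: "U \<in> carrier R" "V \<in> carrier R" "W \<in> carrier R"
    by (simp_all add: U_def V_def W_def)
  have brackets: "\<langle>a, b\<rangle> = U" "\<langle>b, a\<rangle> = U" "\<langle>a, c\<rangle> = V" "\<langle>c, a\<rangle> = V" "\<langle>b, c\<rangle> = W" "\<langle>c, b\<rangle> = W"
    by (simp_all add: U_def V_def W_def bracket_sym)
  have double: "U \<oplus> U = \<zero>" "V \<oplus> V = \<zero>" "W \<oplus> W = \<zero>"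
    by (simp_all add: U_def V_def W_def two_torsion)
  have nz: "V \<noteq> \<zero>" "W \<noteq> \<zero>" "V \<oplus> W \<noteq> \<zero>"
    using even_frame_first_noncommuting[OF frame]
      even_frame_variants[OF frame, THEN even_frame_first_noncommuting]
    by (simp_all add: bracket_add_left brackets)
  have *: "\<langle>r, a\<rangle> = \<zero> \<or> \<langle>r, b\<rangle> = \<zero> \<or> \<langle>r, a \<oplus> b\<rangle> = \<zero>"
    if "r \<in> carrier R" "\<langle>r, c\<rangle> \<noteq> \<zero>" for r
    using even_frame_commutes[OF frame that(1)] that bracket_center(1)[of r c] by auto
  have ac: "U \<oplus> W = \<zero> \<or> U \<oplus> (V \<oplus> W) = \<zero>"
    using *[of "a \<oplus> c"] nz by (simp add: bracket_add_left bracket_add_right brackets a_ac)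
  have bc: "U \<oplus> V = \<zero> \<or> U \<oplus> (V \<oplus> W) = \<zero>"
    using *[of "b \<oplus> c"] nz by (simp add: bracket_add_left bracket_add_right brackets a_ac)
  have "\<langle>a \<oplus> b \<oplus> c, a \<oplus> b\<rangle> = (U \<oplus> U) \<oplus> (V \<oplus> W)"
    by (simp add: bracket_add_left bracket_add_right brackets a_ac)
  then have abc: "U \<oplus> V = \<zero> \<or> U \<oplus> W = \<zero>"
    using *[of "a \<oplus> b \<oplus> c"] nz
    by (simp add: bracket_add_left brackets double)
  have neg: "x = \<ominus> y" if "x \<oplus> y = \<zero>" "x \<in> carrier R" "y \<in> carrier R" for x y
    using that by (simp add: minus_equality)
  show False
  proof (cases "U \<oplus> (V \<oplus> W) = \<zero>")
    case True
    then have "U \<oplus> V \<oplus> W = \<zero>" "U \<oplus> W \<oplus> V = \<zero>"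
      by (simp_all add: a_ac)
    then show False
      using abc nz by auto
  next
    case False
    then have "V = \<ominus> U" "W = \<ominus> U"
      using ac bc neg[of V U] neg[of W U] by (auto simp: a_comm)
    then show False
      using nz double by (simp flip: minus_add)
  qed
qed

end

lemma exists_odd_pair:
  assumes card: "card (ring_Cent R) = 5"
  shows "\<exists>a b. odd_pair a b"
proof (rule ccontr)
  assume "\<nexists>a b. odd_pair a b"
  then have two_torsion: "\<langle>x, y\<rangle> \<oplus> \<langle>x, y\<rangle> = \<zero>" if "x \<in> carrier R" "y \<in> carrier R" for x y
    using that by (auto simp: odd_pair_def)
  have many: "\<exists>r \<in> carrier R. C r \<notin> set Xs" if "length Xs < 5" for Xs
  proof (rule ccontr)
    assume "\<not> ?thesis"
    then have "ring_Cent R \<subseteq> set Xs"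
      by (auto simp: ring_Cent_def)
    then have "card (ring_Cent R) \<le> length Xs"
      by (meson List.finite_set card_length card_mono le_trans)
    then show False
      using that card by simp
  qed
  obtain a where [simp]: "a \<in> carrier R" and a: "C a \<noteq> carrier R"
    using many[of "[carrier R]"] by auto
  then obtain b where b [simp]: "b \<in> carrier R" and u: "\<langle>a, b\<rangle> \<noteq> \<zero>"
    using a by (auto simp: mem_center_iff centralizer_eq_carrier_iff)
  obtain c where c [simp]: "c \<in> carrier R" and new: "C c \<notin> {carrier R, C a, C b, C (a \<oplus> b)}"
    using many[of "[carrier R, C a, C b, C (a \<oplus> b)]"] by auto
  have "C a \<noteq> C c" "C b \<noteq> C c" "C (a \<oplus> b) \<noteq> C c" "carrier R \<noteq> C c"
    using new by auto
  then have "distinct [carrier R, C a, C b, C (a \<oplus> b), C c]"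
    using distinct_three_centralizers[OF _ _ u] by simp
  then have "even_frame a b c"
    using new u Cent_exhausted[OF card] by (simp add: even_frame_def)
  moreover have "\<not> even_frame a b c"
    by (rule no_even_frame) (rule two_torsion)
  ultimately show False
    by contradiction
qed

section \<open>Integer combinations of two elements\<close>

abbreviation int_mult :: "int \<Rightarrow> 'a \<Rightarrow> 'a" (infixr "\<bullet>" 80)
  where "k \<bullet> x \<equiv> add_pow R k x"

abbreviation lin :: "'a \<Rightarrow> 'a \<Rightarrow> int \<Rightarrow> int \<Rightarrow> 'a"
  where "lin a b i j \<equiv> i \<bullet> a \<oplus> j \<bullet> b"

text \<open>
  These two conditions describe \<open>R/Z\<close> and its bracket completely: the bracket of two combinations of
  \<open>a\<close> and \<open>b\<close> is a determinant with values in a group of order three.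
\<close>

definition mod3_plane :: "'a \<Rightarrow> 'a \<Rightarrow> bool"
  where "mod3_plane a b \<longleftrightarrow> a \<in> carrier R \<and> b \<in> carrier R \<and>
    (\<forall>r \<in> carrier R. \<exists>i j. r \<ominus> lin a b i j \<in> Z) \<and> \<langle>a, b\<rangle> \<noteq> \<zero> \<and> 3 \<bullet> \<langle>a, b\<rangle> = \<zero>"

lemma int_mult_closed [simp]: "x \<in> carrier R \<Longrightarrow> k \<bullet> x \<in> carrier R"
  by (rule add.int_pow_closed)

lemma int_mult_add: "x \<in> carrier R \<Longrightarrow> (i + j) \<bullet> x = i \<bullet> x \<oplus> j \<bullet> x"
  by (rule add.int_pow_mult)

lemma int_mult_uminus: "x \<in> carrier R \<Longrightarrow> (- i) \<bullet> x = \<ominus> (i \<bullet> x)"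
  by (rule add.int_pow_neg)

lemma int_mult_mult: "x \<in> carrier R \<Longrightarrow> (i * j) \<bullet> x = i \<bullet> (j \<bullet> x)"
  using add.int_pow_pow[of x i j] by (simp add: mult.commute)

lemma int_mult_0 [simp]: "0 \<bullet> x = \<zero>"
  by (simp add: add_pow_def)

lemma int_mult_1 [simp]: "x \<in> carrier R \<Longrightarrow> 1 \<bullet> x = x"
  by (rule add.int_pow_1)

lemma int_mult_zero [simp]: "k \<bullet> \<zero> = \<zero>"
  by (rule add.int_pow_one)

lemma int_mult_3: "x \<in> carrier R \<Longrightarrow> 3 \<bullet> x = x \<oplus> x \<oplus> x"
  using int_mult_add[of x "1 + 1" 1] int_mult_add[of x 1 1] by simp

lemma bracket_int_mult_left:
  assumes "x \<in> carrier R" "y \<in> carrier R"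
  shows "\<langle>k \<bullet> x, y\<rangle> = k \<bullet> \<langle>x, y\<rangle>"
proof -
  have hom: "group_hom (add_monoid R) (add_monoid R) (\<lambda>x. \<langle>x, y\<rangle>)"
    using assms(2) by (auto intro!: group_hom.intro a_group simp: group_hom_axioms_def hom_def bracket_add_left)
  show ?thesis
    using group_hom.hom_int_pow[OF hom, of x k] assms by (simp add: add_pow_def)
qed

lemma bracket_int_mult_right:
  assumes "x \<in> carrier R" "y \<in> carrier R"
  shows "\<langle>x, k \<bullet> y\<rangle> = k \<bullet> \<langle>x, y\<rangle>"
proof -
  have hom: "group_hom (add_monoid R) (add_monoid R) (\<lambda>y. \<langle>x, y\<rangle>)"
    using assms(1) by (auto intro!: group_hom.intro a_group simp: group_hom_axioms_def hom_def bracket_add_right)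
  show ?thesis
    using group_hom.hom_int_pow[OF hom, of y k] assms by (simp add: add_pow_def)
qed

lemma bracket_lin:
  assumes [simp]: "a \<in> carrier R" "b \<in> carrier R"
  shows "\<langle>lin a b i j, lin a b k l\<rangle> = (i * l - j * k) \<bullet> \<langle>a, b\<rangle>"
proof -
  have "\<langle>lin a b i j, lin a b k l\<rangle> = (i * l) \<bullet> \<langle>a, b\<rangle> \<oplus> (j * k) \<bullet> \<langle>b, a\<rangle>"
    by (simp add: bracket_add_left bracket_add_right bracket_int_mult_left
        bracket_int_mult_right a_comm mult.commute flip: int_mult_mult)
  also have "(j * k) \<bullet> \<langle>b, a\<rangle> = (- (j * k)) \<bullet> \<langle>a, b\<rangle>"
    by (simp add: bracket_swap[of a b] int_mult_uminus add.int_pow_inv)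
  also have "(i * l) \<bullet> \<langle>a, b\<rangle> \<oplus> (- (j * k)) \<bullet> \<langle>a, b\<rangle> = (i * l - j * k) \<bullet> \<langle>a, b\<rangle>"
    by (simp flip: int_mult_add)
  finally show ?thesis .
qed

lemma int_mult_eq_zero_iff_dvd:
  assumes p: "Factorial_Ring.prime p" and [simp]: "u \<in> carrier R" and u: "u \<noteq> \<zero>" "p \<bullet> u = \<zero>"
  shows "k \<bullet> u = \<zero> \<longleftrightarrow> p dvd k"
proof
  assume "p dvd k"
  then obtain m where "k = m * p"
    by (metis dvdE mult.commute)
  then show "k \<bullet> u = \<zero>"
    using u by (simp add: int_mult_mult)
next
  assume k: "k \<bullet> u = \<zero>"
  show "p dvd k"
  proof (rule ccontr)
    assume "\<not> p dvd k"
    then have "coprime p k"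
      using p prime_imp_coprime by blast
    then obtain s t where "s * p + t * k = 1"
      using bezout_int[of p k] by auto
    then have "u = (s * p + t * k) \<bullet> u"
      by simp
    also have "\<dots> = \<zero>"
      using u k by (simp only: int_mult_add int_mult_mult assms(2) int_mult_zero l_zero zero_closed)
    finally show False
      using u by simp
  qed
qed

section \<open>Five centralizers and planes modulo three\<close>

text \<open>
  Every noncentral element has the centralizer of \<open>a\<close>, \<open>b\<close>, \<open>a + b\<close> or \<open>a - b\<close>, and each of these is the
  first component of an odd pair, so \<open>odd_pair_coset\<close> places the element in its span.
\<close>

lemma exists_mod3_plane:
  assumes card: "card (ring_Cent R) = 5"
  shows "\<exists>a b. mod3_plane a b"
proof -
  obtain a b where ab: "odd_pair a b"
    using exists_odd_pair[OF card] by blast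
  then have [simp]: "a \<in> carrier R" "b \<in> carrier R" and u: "\<langle>a, b\<rangle> \<noteq> \<zero>"
    using odd_pair_bracket by (auto simp: odd_pair_def)
  define spanned where "spanned r \<longleftrightarrow> (\<exists>i j. r \<ominus> lin a b i j \<in> Z)" for r
  have span_step: "spanned c"
    if c: "odd_pair (lin a b i j) d" "c \<in> carrier R" "C c = C (lin a b i j)" for c d i j
  proof -
    let ?x = "lin a b i j"
    have "\<langle>?x, c\<rangle> = \<zero>"
      using bracket_eq_zero_if_centralizer_eq[of ?x c] c by simp
    then consider "c \<in> Z" | "c \<ominus> ?x \<in> Z" | "c \<oplus> ?x \<in> Z"
      using odd_pair_coset[OF card c(1,2)] by blast
    then show ?thesis
    proof cases
      case 1
      then have "c \<ominus> lin a b 0 0 \<in> Z"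
        using c(2) by (simp add: a_minus_def)
      then show ?thesis
        unfolding spanned_def by blast
    next
      case 2
      then show ?thesis
        unfolding spanned_def by blast
    next
      case 3
      then have "c \<ominus> lin a b (- i) (- j) \<in> Z"
        using c(2) by (simp add: a_minus_def int_mult_uminus minus_add minus_minus)
      then show ?thesis
        unfolding spanned_def by blast
    qed
  qed
  have lins: "lin a b 1 0 = a" "lin a b 0 1 = b" "lin a b 1 1 = a \<oplus> b" "lin a b 1 (- 1) = a \<ominus> b"
    by (simp_all add: int_mult_uminus a_minus_def)
  have "spanned r" if r: "r \<in> carrier R" for r
  proof -
    consider "C r = carrier R" | "C r = C a" | "C r = C b" | "C r = C (a \<oplus> b)" | "C r = C (a \<ominus> b)"
      using odd_pair_classes[OF card ab r] by auto
    then show ?thesis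
    proof cases
      case 1
      then have "r \<ominus> lin a b 0 0 \<in> Z"
        using r by (simp add: a_minus_def centralizer_eq_carrier_iff)
      then show ?thesis
        unfolding spanned_def by blast
    next
      case 2
      then show ?thesis
        using span_step[of 1 0 b r] ab r by (simp only: lins)
    next
      case 3
      then show ?thesis
        using span_step[of 0 1 a r] odd_pair_variants(1)[OF ab] r by (simp only: lins)
    next
      case 4
      then show ?thesis
        using span_step[of 1 1 b r] odd_pair_variants(2)[OF ab] r by (simp only: lins)
    next
      case 5
      then show ?thesis
        using span_step[of 1 "- 1" b r] odd_pair_variants(3)[OF ab] r by (simp only: lins)
    qed
  qed
  then have "mod3_plane a b"
    using u odd_pair_torsion[OF card ab] by (simp add: mod3_plane_def int_mult_3 flip: spanned_def)
  then show ?thesis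
    by blast
qed

text \<open>
  The brackets of \<open>ia + jb\<close> with \<open>b\<close> and \<open>a\<close> are \<open>i[a, b]\<close> and \<open>-j[a, b]\<close>, and since \<open>a\<close> and \<open>b\<close> span the ring
  modulo \<open>Z\<close>, only these two have to vanish.
\<close>

lemma mod3_plane_mem_center_iff:
  assumes ab: "mod3_plane a b"
  shows "lin a b i j \<in> Z \<longleftrightarrow> 3 dvd i \<and> 3 dvd j"
proof -
  have [simp]: "a \<in> carrier R" "b \<in> carrier R"
    and span: "\<And>r. r \<in> carrier R \<Longrightarrow> \<exists>k l. r \<ominus> lin a b k l \<in> Z"
    and u: "\<langle>a, b\<rangle> \<noteq> \<zero>" "3 \<bullet> \<langle>a, b\<rangle> = \<zero>"
    using ab by (auto simp: mod3_plane_def)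
  have dvd: "k \<bullet> \<langle>a, b\<rangle> = \<zero> \<longleftrightarrow> 3 dvd k" for k :: int
    using u by (intro int_mult_eq_zero_iff_dvd) auto
  show ?thesis
  proof
    assume "lin a b i j \<in> Z"
    then have "\<langle>lin a b i j, lin a b 0 1\<rangle> = \<zero>" "\<langle>lin a b i j, lin a b 1 0\<rangle> = \<zero>"
      by (simp_all add: bracket_center)
    then show "3 dvd i \<and> 3 dvd j"
      by (simp only: bracket_lin dvd \<open>a \<in> carrier R\<close> \<open>b \<in> carrier R\<close>) simp
  next
    assume ij: "3 dvd i \<and> 3 dvd j"
    have "\<langle>r, lin a b i j\<rangle> = \<zero>" if r: "r \<in> carrier R" for r
    proof -
      obtain k l where "r \<ominus> lin a b k l \<in> Z"
        using span r by blast
      then have "C r = C (lin a b k l)"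
        using r by (intro centralizer_cong_center) auto
      moreover have "\<langle>lin a b k l, lin a b i j\<rangle> = \<zero>"
        using ij by (simp add: bracket_lin dvd)
      ultimately show ?thesis
        using r mem_centralizer_iff[of r "lin a b i j"] mem_centralizer_iff[of "lin a b k l" "lin a b i j"]
        by simp
    qed
    then show "lin a b i j \<in> Z"
      by (simp add: mem_center_iff bracket_eq_zero_sym)
  qed
qed

lemma lin_diff:
  assumes [simp]: "a \<in> carrier R" "b \<in> carrier R"
  shows "lin a b i j \<ominus> lin a b k l = lin a b (i - k) (j - l)"
  using int_mult_add[of a i "- k"] int_mult_add[of b j "- l"]
  by (simp add: a_minus_def int_mult_uminus minus_add a_ac)

text \<open>
  The centralizer of \<open>ia + jb\<close> depends only on \<open>i\<close> and \<open>j\<close> modulo \<open>3\<close>, and is unchanged when both change sign.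
  So the nine cosets of \<open>Z\<close> give the whole ring and one centralizer for each of four pairs \<open>\<plusminus>(i, j)\<close>.
\<close>

lemma mod3_plane_card_Cent:
  assumes ab: "mod3_plane a b"
  shows "card (ring_Cent R) = 5"
proof -
  have [simp]: "a \<in> carrier R" "b \<in> carrier R"
    and span: "\<And>r. r \<in> carrier R \<Longrightarrow> \<exists>k l. r \<ominus> lin a b k l \<in> Z"
    and u: "\<langle>a, b\<rangle> \<noteq> \<zero>" "3 \<bullet> \<langle>a, b\<rangle> = \<zero>"
    using ab by (auto simp: mod3_plane_def)
  \<comment> \<open>If \<open>2[a, b]\<close> vanished, so would \<open>[a, b] = 3[a, b] - 2[a, b]\<close>.\<close>
  have dbl: "\<langle>a, b\<rangle> \<oplus> \<langle>a, b\<rangle> \<noteq> \<zero>"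
    using u int_mult_3[of "\<langle>a, b\<rangle>"] by auto
  have pair: "odd_pair a b"
    using dbl by (simp add: odd_pair_def)
  let ?Cs = "[carrier R, C a, C b, C (a \<oplus> b), C (a \<ominus> b)]"
  have negs: "C (lin a b (- i) (- j)) = C (lin a b i j)" for i j
    using centralizer_uminus[of "lin a b i j"] by (simp add: int_mult_uminus minus_add)
  have reps: "C (lin a b 0 0) = carrier R" "C (lin a b 1 0) = C a" "C (lin a b 0 1) = C b"
    "C (lin a b 1 1) = C (a \<oplus> b)" "C (lin a b 1 (- 1)) = C (a \<ominus> b)"
    "C (lin a b (- 1) 0) = C a" "C (lin a b 0 (- 1)) = C b"
    "C (lin a b (- 1) (- 1)) = C (a \<oplus> b)" "C (lin a b (- 1) 1) = C (a \<ominus> b)"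
    using negs[of 1 0] negs[of 0 1] negs[of 1 1] negs[of 1 "- 1"]
      centralizer_eq_carrier_iff[of \<zero>] zero_mem_center
    by (simp_all add: int_mult_uminus a_minus_def minus_minus)
  have "C r \<in> set ?Cs" if r: "r \<in> carrier R" for r
  proof -
    obtain k l where kl: "r \<ominus> lin a b k l \<in> Z"
      using span r by blast
    obtain e f where ef: "e \<in> {-1, 0, 1}" "f \<in> {-1, 0, 1}" "3 dvd k - e" "3 dvd l - f"
    proof -
      have "\<exists>e \<in> {-1, 0, 1}. 3 dvd k - e" for k :: int
        by simp presburger
      then show ?thesis
        using that by blast
    qed
    have "lin a b k l \<ominus> lin a b e f \<in> Z"
      using ef by (simp add: lin_diff mod3_plane_mem_center_iff[OF ab])
    then have "C r = C (lin a b e f)"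
      using centralizer_cong_center[OF r _ kl] centralizer_cong_center[of "lin a b k l" "lin a b e f"]
      by simp
    moreover have "C (lin a b e f) \<in> set ?Cs"
      using ef(1,2) by (elim insertE emptyE) (simp_all only: reps list.set insert_iff simp_thms)
    ultimately show ?thesis
      by simp
  qed
  then have "ring_Cent R \<subseteq> set ?Cs"
    by (auto simp: ring_Cent_def)
  moreover have "set ?Cs \<subseteq> ring_Cent R"
    using carrier_mem_Cent by (auto simp: ring_Cent_def)
  ultimately have "ring_Cent R = set ?Cs"
    by (rule equalityI)
  then show ?thesis
    using distinct_card[OF odd_pair_distinct[OF pair]] by simp
qed

text \<open>
  A basis of \<open>R/Z\<close> in the sense of \<open>iso_DirProd_integer_mod_group_iff\<close> is a pair of cosets of elements
  \<open>a\<close>, \<open>b\<close>, so both sides are statements about the combinations \<open>ia + jb\<close>.  From a basis one gets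
  \<open>3[a, b] = [3a, b] = 0\<close>, and \<open>[a, b] \<noteq> 0\<close> since otherwise \<open>a\<close> would commute with everything and be central.
\<close>

lemma center_quotient_iso_iff_mod3_plane:
  "add_monoid R Mod Z \<cong> integer_mod_group 3 \<times>\<times> integer_mod_group 3 \<longleftrightarrow> (\<exists>a b. mod3_plane a b)"
proof -
  interpret N: normal Z "add_monoid R"
    by (rule ring_center_normal)
  let ?Q = "add_monoid R Mod Z"
  define cos where "cos r = Z #>\<^bsub>add_monoid R\<^esub> r" for r
  interpret Q: comm_group ?Q
    using comm_group.abelian_FactGroup[OF a_comm_group N.subgroup_axioms] .
  have carr: "carrier ?Q = cos ` carrier R"
    by (simp add: carrier_FactGroup cos_def)
  have cos_comb: "cos a [^]\<^bsub>?Q\<^esub> i \<otimes>\<^bsub>?Q\<^esub> cos b [^]\<^bsub>?Q\<^esub> j = cos (lin a b i j)"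
    if "a \<in> carrier R" "b \<in> carrier R" for a b and i j :: int
    using that N.FactGroup_int_pow[of a i] N.FactGroup_int_pow[of b j]
      N.rcos_sum[of "i \<bullet> a" "j \<bullet> b"] int_mult_closed[of a i] int_mult_closed[of b j]
    by (simp add: cos_def add_pow_def)
  have cos_eq: "cos r = cos s \<longleftrightarrow> r \<ominus> s \<in> Z" if "r \<in> carrier R" "s \<in> carrier R" for r s
  proof -
    have "cos r = cos s \<longleftrightarrow> r \<in> cos s"
      unfolding cos_def using that add.repr_independence[OF _ _ N.subgroup_axioms]
        add.rcos_self[OF _ N.subgroup_axioms] by metis
    also have "\<dots> \<longleftrightarrow> r \<ominus> s \<in> Z"
      using N.rcos_module[OF a_group, of s r] that by (simp add: cos_def a_minus_def a_inv_def)
    finally show ?thesis .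
  qed
  have cos_one: "cos r = \<one>\<^bsub>?Q\<^esub> \<longleftrightarrow> r \<in> Z" if "r \<in> carrier R" for r
    using add.coset_join1[OF _ that N.subgroup_axioms] add.coset_join2[OF that N.subgroup_axioms]
    by (auto simp: cos_def)
  show ?thesis
  proof
    assume "?Q \<cong> integer_mod_group 3 \<times>\<times> integer_mod_group 3"
    then obtain x y where "x \<in> carrier ?Q" "y \<in> carrier ?Q"
      and xy: "\<forall>g \<in> carrier ?Q. \<exists>(i :: int) (j :: int). g = x [^]\<^bsub>?Q\<^esub> i \<otimes>\<^bsub>?Q\<^esub> y [^]\<^bsub>?Q\<^esub> j"
        "\<forall>(i :: int) (j :: int). x [^]\<^bsub>?Q\<^esub> i \<otimes>\<^bsub>?Q\<^esub> y [^]\<^bsub>?Q\<^esub> j = \<one>\<^bsub>?Q\<^esub> \<longleftrightarrow>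
          int 3 dvd i \<and> int 3 dvd j"
      unfolding Q.iso_DirProd_integer_mod_group_iff by - (elim bexE conjE, rule that)
    then obtain a b where [simp]: "a \<in> carrier R" "b \<in> carrier R" and "x = cos a" "y = cos b"
      by (auto simp: carr)
    note xy = xy[unfolded this cos_comb[OF \<open>a \<in> carrier R\<close> \<open>b \<in> carrier R\<close>]]
    have span: "\<exists>i j. cos r = cos (lin a b i j)" if "r \<in> carrier R" for r
      using xy(1) that by (simp add: carr)
    have rel: "lin a b i j \<in> Z \<longleftrightarrow> 3 dvd i \<and> 3 dvd j" for i j
      using xy(2) cos_one[of "lin a b i j"] by simp
    have span': "\<exists>i j. r \<ominus> lin a b i j \<in> Z" if "r \<in> carrier R" for r
      using span[OF that] that by (simp add: cos_eq)
    have "\<langle>a, b\<rangle> \<noteq> \<zero>"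
    proof
      assume u: "\<langle>a, b\<rangle> = \<zero>"
      have "\<langle>r, a\<rangle> = \<zero>" if r: "r \<in> carrier R" for r
      proof -
        obtain k l where "r \<ominus> lin a b k l \<in> Z"
          using span' r by blast
        then have "C r = C (lin a b k l)"
          using r by (intro centralizer_cong_center) auto
        moreover have "a \<in> C (lin a b k l)"
          using bracket_lin[of a b k l 1 0] u by (simp add: mem_centralizer_iff)
        ultimately show ?thesis
          using r mem_centralizer_iff[of r a] by simp
      qed
      then have "lin a b 1 0 \<in> Z"
        by (simp add: mem_center_iff bracket_eq_zero_sym)
      then show False
        using rel[of 1 0] by simp
    qed
    moreover have "3 \<bullet> \<langle>a, b\<rangle> = \<zero>"
    proof -
      have "lin a b 3 0 \<in> Z"
        using rel[of 3 0] by simp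
      then have "\<langle>lin a b 3 0, b\<rangle> = \<zero>"
        by (rule bracket_center) simp
      then show ?thesis
        by (simp add: bracket_int_mult_left)
    qed
    ultimately have "mod3_plane a b"
      using span' by (simp add: mod3_plane_def)
    then show "\<exists>a b. mod3_plane a b"
      by blast
  next
    assume "\<exists>a b. mod3_plane a b"
    then obtain a b where ab: "mod3_plane a b"
      by blast
    then have [simp]: "a \<in> carrier R" "b \<in> carrier R"
      and span: "\<And>r. r \<in> carrier R \<Longrightarrow> \<exists>i j. r \<ominus> lin a b i j \<in> Z"
      by (auto simp: mod3_plane_def)
    show "?Q \<cong> integer_mod_group 3 \<times>\<times> integer_mod_group 3"
      unfolding Q.iso_DirProd_integer_mod_group_iff
    proof (rule bexI[of _ "cos a"], rule bexI[of _ "cos b"], intro conjI ballI allI)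
      show "cos a \<in> carrier ?Q" "cos b \<in> carrier ?Q"
        by (simp_all add: carr)
      fix i j :: int
      show "cos a [^]\<^bsub>?Q\<^esub> i \<otimes>\<^bsub>?Q\<^esub> cos b [^]\<^bsub>?Q\<^esub> j = \<one>\<^bsub>?Q\<^esub> \<longleftrightarrow> int 3 dvd i \<and> int 3 dvd j"
        using mod3_plane_mem_center_iff[OF ab] cos_comb cos_one by simp
    next
      fix g assume "g \<in> carrier ?Q"
      then obtain r where r: "r \<in> carrier R" "g = cos r"
        by (auto simp: carr)
      obtain i j where "r \<ominus> lin a b i j \<in> Z"
        using span r by blast
      then have "g = cos a [^]\<^bsub>?Q\<^esub> i \<otimes>\<^bsub>?Q\<^esub> cos b [^]\<^bsub>?Q\<^esub> j"
        using r cos_comb cos_eq by simp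
      then show "\<exists>(i :: int) (j :: int). g = cos a [^]\<^bsub>?Q\<^esub> i \<otimes>\<^bsub>?Q\<^esub> cos b [^]\<^bsub>?Q\<^esub> j"
        by blast
    qed
  qed
qed

end

theorem theorem4p3:
  fixes R (structure)
  assumes "nonunital_ring R" and "finite (carrier R)"
  shows "card (ring_Cent R) = 5 \<longleftrightarrow>
    add_monoid R Mod ring_center R \<cong> integer_mod_group 3 \<times>\<times> integer_mod_group 3"
proof -
  interpret nonunital_ring R
    by fact
  show ?thesis
    using exists_mod3_plane mod3_plane_card_Cent center_quotient_iso_iff_mod3_plane by blast
qed

end
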